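(* Let $N,M\ge1$ be integers, $\alpha,T_q>0$, $\eta_e,\eta_r,\eta_d,\lambda_m\in(0,1]$, $P_e,P_r,P_d\in[0,1)$ with $P_r\neq1/2$. Let $R_N(L)$, $R_N^{(0)}(L)$ and $L_{\rm max}$ be as in the context, and let $\eta=e^{-\alpha L}$. Put $$A=\frac{\eta_d^2}{\eta_r^2\lambda_m^2T_q},\quad B=\frac{\eta_r^2\lambda_m^2\eta_e^2M}{4},\quad R_{\rm max}=A\left(\frac{\eta_r^2\lambda_m^2}{2}\right)^N,\quad \eta'=\left(\frac{2}{M\eta_e^2}\right)^N,\quad L'=-\frac{\log\eta'}{\alpha}.$$ Assume that non-zero dark-click probabilities cannot improve the key rate, i.e. $R_N(L)\le R_N^{(0)}(L)$ for all $L\ge0$. Then $$R_N(L)\le\begin{cases}R_{\rm max}, & 0\le L\le L',\\ \eta\,(AB^N), & L'<L<L_{\rm max},\\ 0, & L\ge L_{\rm max}.\end{cases}$$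
   Context: Logarithms are natural unless a base is indicated. $R_N(L)$ is the secret-key rate at total range $L\ge0$ divided into $N$ equal elementary links, defined as follows. Let $\lambda=e^{-\alpha L/(2N)}$. Put $A_r=\eta_r\lambda_m+P_r(1-\eta_r\lambda_m)$, $B_r=1-(1-P_r)(1-\eta_r\lambda_m)^2$, $$a=\tfrac18\left[P_r^2(1-A_r)^2+A_r^2(1-P_r)^2\right],\quad b=\tfrac18\left[2A_rP_r(1-A_r)(1-P_r)\right],\quad c=\tfrac18P_r(1-P_r)\left[P_r(1-B_r)+B_r(1-P_r)\right],$$ and let $a_e,b_e,c_e$ be the same expressions with $(P_r,A_r,B_r)$ replaced by $(P_e,A_e,B_e)$, $A_e=\eta_e\lambda+P_e(1-\eta_e\lambda)$, $B_e=1-(1-P_e)(1-\eta_e\lambda)^2$. Put $s=a+b+2c$, $s_1=a_e+b_e+2c_e$, $t_r=(a+b-2c)/(a+b+2c)$, $t_e=(a_e+b_e-2c_e)/(a_e+b_e+2c_e)$, $A_d=\eta_d+(1-\eta_d)P_d$, $q_1=(1-P_d)A_d$, $q_2=(1-A_d)P_d$, $q_3=P_dA_d$, $t_d=((q_1-q_2)/(q_1+q_2+q_3))^2$, $P_1=(q_1+q_2+q_3)^2$, $$P_{\rm succ}=(4s)^{N-1}\left(1-(1-4s_1)^M\right)^N,\qquad Q(N)=\tfrac12\left[1-\tfrac{t_d}{t_r}(t_rt_e)^N\right].$$ Let $h_2(x)=-x\log_2x-(1-x)\log_2(1-x)$, $R_2(Q)=1-2h_2(Q)$, and let $Q_{\rm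 th}\in(0,1/2)$ be defined by $h_2(Q_{\rm th})=1/2$ ($Q_{\rm th}\approx0.1104$). Then $$R_N(L)=\frac{P_1P_{\rm succ}R_2(Q(N))}{2T_q}\quad\text{if }Q(N)<Q_{\rm th},\qquad R_N(L)=0\ \text{ if }Q(N)\ge Q_{\rm th}.$$ $R_N^{(0)}(L)$ is the same quantity with $P_e=P_r=P_d=0$ (all other parameters unchanged). $L_{\rm max}\in[0,\infty]$ is the maximum range at which a non-zero rate is possible: $L_{\rm max}=\sup\{L\ge0: Q(N)<Q_{\rm th}\}$ (with $\sup\emptyset=0$); it is $+\infty$ when $P_e=P_r=P_d=0$. *)

theory Defs
  imports "HOL-Analysis.Analysis"
begin

text \<open>Below, \<open>l\<close> is the transmissivity multiplying a detector efficiency \<open>\<eta>\<close>: the parameter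
  \<open>l\<^sub>m\<close> (for \<open>\<lambda>\<close> with subscript \<open>m\<close>, not an identifier here) for the quantities with index \<open>r\<close>, and
  \<open>link_trans \<alpha> N L\<close>, which is \<open>\<lambda>\<close>, for those with index \<open>e\<close>.\<close>

definition click_A :: "real \<Rightarrow> real \<Rightarrow> real \<Rightarrow> real" where
  "click_A \<eta> l P = \<eta> * l + P * (1 - \<eta> * l)"

definition click_B :: "real \<Rightarrow> real \<Rightarrow> real \<Rightarrow> real" where
  "click_B \<eta> l P = 1 - (1 - P) * (1 - \<eta> * l)^2"

definition coeff_a :: "real \<Rightarrow> real \<Rightarrow> real \<Rightarrow> real" where
  "coeff_a \<eta> l P = (let A = click_A \<eta> l P in
     1/8 * (P^2 * (1 - A)^2 + A^2 * (1 - P)^2))"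

definition coeff_b :: "real \<Rightarrow> real \<Rightarrow> real \<Rightarrow> real" where
  "coeff_b \<eta> l P = (let A = click_A \<eta> l P in
     1/8 * (2 * A * P * (1 - A) * (1 - P)))"

definition coeff_c :: "real \<Rightarrow> real \<Rightarrow> real \<Rightarrow> real" where
  "coeff_c \<eta> l P = (let B = click_B \<eta> l P in
     1/8 * P * (1 - P) * (P * (1 - B) + B * (1 - P)))"

definition swap_s :: "real \<Rightarrow> real \<Rightarrow> real \<Rightarrow> real" where
  "swap_s \<eta> l P = coeff_a \<eta> l P + coeff_b \<eta> l P + 2 * coeff_c \<eta> l P"

definition swap_t :: "real \<Rightarrow> real \<Rightarrow> real \<Rightarrow> real" where
  "swap_t \<eta> l P = (coeff_a \<eta> l P + coeff_b \<eta> l P - 2 * coeff_c \<eta> l P)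
     / (coeff_a \<eta> l P + coeff_b \<eta> l P + 2 * coeff_c \<eta> l P)"

definition link_trans :: "real \<Rightarrow> nat \<Rightarrow> real \<Rightarrow> real" where
  "link_trans \<alpha> N L = exp (- \<alpha> * L / (2 * real N))"

definition click_Ad :: "real \<Rightarrow> real \<Rightarrow> real" where
  "click_Ad \<eta>\<^sub>d P\<^sub>d = \<eta>\<^sub>d + (1 - \<eta>\<^sub>d) * P\<^sub>d"

definition q1 :: "real \<Rightarrow> real \<Rightarrow> real" where
  "q1 \<eta>\<^sub>d P\<^sub>d = (1 - P\<^sub>d) * click_Ad \<eta>\<^sub>d P\<^sub>d"

definition q2 :: "real \<Rightarrow> real \<Rightarrow> real" where
  "q2 \<eta>\<^sub>d P\<^sub>d = (1 - click_Ad \<eta>\<^sub>d P\<^sub>d) * P\<^sub>d"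

definition q3 :: "real \<Rightarrow> real \<Rightarrow> real" where
  "q3 \<eta>\<^sub>d P\<^sub>d = P\<^sub>d * click_Ad \<eta>\<^sub>d P\<^sub>d"

definition det_t :: "real \<Rightarrow> real \<Rightarrow> real" where
  "det_t \<eta>\<^sub>d P\<^sub>d = ((q1 \<eta>\<^sub>d P\<^sub>d - q2 \<eta>\<^sub>d P\<^sub>d)
     / (q1 \<eta>\<^sub>d P\<^sub>d + q2 \<eta>\<^sub>d P\<^sub>d + q3 \<eta>\<^sub>d P\<^sub>d))^2"

definition det_P1 :: "real \<Rightarrow> real \<Rightarrow> real" where
  "det_P1 \<eta>\<^sub>d P\<^sub>d = (q1 \<eta>\<^sub>d P\<^sub>d + q2 \<eta>\<^sub>d P\<^sub>d + q3 \<eta>\<^sub>d P\<^sub>d)^2"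

definition P_succ :: "nat \<Rightarrow> nat \<Rightarrow> real \<Rightarrow> real \<Rightarrow> real \<Rightarrow> real \<Rightarrow> real \<Rightarrow> real \<Rightarrow> real \<Rightarrow> real" where
  "P_succ N M \<alpha> \<eta>\<^sub>e \<eta>\<^sub>r l\<^sub>m P\<^sub>e P\<^sub>r L =
     (4 * swap_s \<eta>\<^sub>r l\<^sub>m P\<^sub>r)^(N - 1)
       * (1 - (1 - 4 * swap_s \<eta>\<^sub>e (link_trans \<alpha> N L) P\<^sub>e)^M)^N"

definition QBER :: "nat \<Rightarrow> real \<Rightarrow> real \<Rightarrow> real \<Rightarrow> real \<Rightarrow> real \<Rightarrow> real \<Rightarrow> real \<Rightarrow> real \<Rightarrow> real \<Rightarrow> real" where
  "QBER N \<alpha> \<eta>\<^sub>e \<eta>\<^sub>r \<eta>\<^sub>d l\<^sub>m P\<^sub>e P\<^sub>r P\<^sub>d L =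
     1/2 * (1 - det_t \<eta>\<^sub>d P\<^sub>d / swap_t \<eta>\<^sub>r l\<^sub>m P\<^sub>r
       * (swap_t \<eta>\<^sub>r l\<^sub>m P\<^sub>r * swap_t \<eta>\<^sub>e (link_trans \<alpha> N L) P\<^sub>e)^N)"

text \<open>Since \<open>log 2 0 = 0\<close>, the usual convention \<open>h\<^sub>2 0 = h\<^sub>2 1 = 0\<close> holds.\<close>

definition h2 :: "real \<Rightarrow> real" where
  "h2 x = - x * log 2 x - (1 - x) * log 2 (1 - x)"

definition R2 :: "real \<Rightarrow> real" where
  "R2 Q = 1 - 2 * h2 Q"

definition Q_th :: real where
  "Q_th = (THE q. 0 < q \<and> q < 1/2 \<and> h2 q = 1/2)"

definition key_rate ::
  "nat \<Rightarrow> nat \<Rightarrow> real \<Rightarrow> real \<Rightarrow> real \<Rightarrow> real \<Rightarrow> real \<Rightarrow> real \<Rightarrow> real \<Rightarrow> real \<Rightarrow> real \<Rightarrow> real \<Rightarrow> real" where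
  "key_rate N M \<alpha> T\<^sub>q \<eta>\<^sub>e \<eta>\<^sub>r \<eta>\<^sub>d l\<^sub>m P\<^sub>e P\<^sub>r P\<^sub>d L =
     (let Q = QBER N \<alpha> \<eta>\<^sub>e \<eta>\<^sub>r \<eta>\<^sub>d l\<^sub>m P\<^sub>e P\<^sub>r P\<^sub>d L in
      if Q < Q_th
      then det_P1 \<eta>\<^sub>d P\<^sub>d * P_succ N M \<alpha> \<eta>\<^sub>e \<eta>\<^sub>r l\<^sub>m P\<^sub>e P\<^sub>r L * R2 Q / (2 * T\<^sub>q)
      else 0)"

definition key_rate0 ::
  "nat \<Rightarrow> nat \<Rightarrow> real \<Rightarrow> real \<Rightarrow> real \<Rightarrow> real \<Rightarrow> real \<Rightarrow> real \<Rightarrow> real \<Rightarrow> real" where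
  "key_rate0 N M \<alpha> T\<^sub>q \<eta>\<^sub>e \<eta>\<^sub>r \<eta>\<^sub>d l\<^sub>m L = key_rate N M \<alpha> T\<^sub>q \<eta>\<^sub>e \<eta>\<^sub>r \<eta>\<^sub>d l\<^sub>m 0 0 0 L"

text \<open>The supremum is taken in \<open>[0, \<infinity>]\<close>, where the empty set has supremum \<open>0\<close> and unbounded
  sets have supremum \<open>\<infinity>\<close>.\<close>

definition L_max :: "nat \<Rightarrow> real \<Rightarrow> real \<Rightarrow> real \<Rightarrow> real \<Rightarrow> real \<Rightarrow> real \<Rightarrow> real \<Rightarrow> real \<Rightarrow> ennreal" where
  "L_max N \<alpha> \<eta>\<^sub>e \<eta>\<^sub>r \<eta>\<^sub>d l\<^sub>m P\<^sub>e P\<^sub>r P\<^sub>d =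
     (SUP L\<in>{L::real. 0 \<le> L \<and> QBER N \<alpha> \<eta>\<^sub>e \<eta>\<^sub>r \<eta>\<^sub>d l\<^sub>m P\<^sub>e P\<^sub>r P\<^sub>d L < Q_th}. ennreal L)"

lemma h2_deriv:
  assumes "0 < x" "x < 1"
  shows "(h2 has_real_derivative (ln (1 - x) - ln x) / ln 2) (at x)"
proof -
  have h: "h2 = (\<lambda>x. (- x * ln x - (1 - x) * ln (1 - x)) / ln 2)"
    by (auto simp: h2_def log_def diff_divide_distrib)
  have d: "((\<lambda>x. - x * ln x - (1 - x) * ln (1 - x)) has_real_derivative
      ln (1 - x) - ln x) (at x)"
    using assms by (auto intro!: derivative_eq_intros)
  show ?thesis unfolding h by (rule DERIV_cdivide [OF d])
qed

lemma h2_strict_mono: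
  assumes "0 < x" "x < y" "y < 1/2"
  shows "h2 x < h2 y"
proof (rule DERIV_pos_imp_increasing [OF assms(2)])
  fix z assume "x \<le> z" "z \<le> y"
  with assms have z: "0 < z" "z < 1/2" by auto
  then have "0 < (ln (1 - z) - ln z) / ln 2" by simp
  with z h2_deriv [of z] show "\<exists>d. (h2 has_real_derivative d) (at z) \<and> d > 0" by force
qed

lemma ex1_Q_th: "\<exists>!q. 0 < q \<and> q < 1/2 \<and> h2 q = 1/2"
proof (rule ex_ex1I)
  have l16: "log 2 (1/16) = -4" 
    using log_nat_power[of 2 2 4] by (simp add: log_divide)
  have l1516: "log 2 (15/16) = log 2 15 - log 2 16" by (subst log_divide) auto
  have "log 2 16 = (4::real)" using log_nat_power[of 2 2 4] by simp
  moreover have "log 2 15 \<ge> log 2 (8::real)" by simp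
  moreover have "log 2 8 = (3::real)" using log_nat_power[of 2 2 3] by simp
  ultimately have m: "- log 2 (15/16) \<le> (1::real)" using l1516 by linarith
  have "ln (16/15) \<le> (1/15::real)" using ln_add_one_self_le_self[of "1/15"] by simp
  moreover have "ln 2 \<ge> (1/2::real)" using ln_le_minus_one [of "1/2"] by (simp add: ln_div)
  ultimately have "ln (16/15) / ln 2 \<le> (1/15) / (1/2::real)"
    by (intro frac_le) auto
  moreover have "- log 2 (15/16::real) = ln (16/15) / ln 2"
    by (simp add: log_def ln_div field_simps)
  ultimately have "- log 2 (15/16::real) \<le> 2/15" by simp
  then have lo: "h2 (1/16) \<le> 1/2" by (simp add: h2_def l16)
  have hi: "1/2 \<le> h2 (1/2)" by (simp add: h2_def log_divide)
  have "continuous_on {1/16..1/2} h2"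
    by (rule continuous_at_imp_continuous_on) (auto intro!: DERIV_isCont h2_deriv)
  then obtain q where "1/16 \<le> q" "q \<le> 1/2" "h2 q = 1/2"
    using IVT' [of h2 "1/16" "1/2" "1/2"] lo hi by auto
  moreover have "h2 (1/2) = 1" by (simp add: h2_def log_divide)
  ultimately have "0 < q \<and> q < 1/2 \<and> h2 q = 1/2"
    by (cases "q = 1/2") auto
  then show "\<exists>q. 0 < q \<and> q < 1/2 \<and> h2 q = 1/2" by blast
next
  fix x y assume "0 < x \<and> x < 1/2 \<and> h2 x = 1/2" "0 < y \<and> y < 1/2 \<and> h2 y = 1/2"
  then show "x = y" using h2_strict_mono [of x y] h2_strict_mono [of y x]
    by (cases x y rule: linorder_cases) auto
qed

lemma Q_th: "0 < Q_th" "Q_th < 1/2" "h2 Q_th = 1/2"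
  using theI' [OF ex1_Q_th] unfolding Q_th_def by auto

lemma L_max_no_dark:
  assumes "0 < \<eta>\<^sub>e" "0 < \<eta>\<^sub>r" "0 < \<eta>\<^sub>d" "0 < l\<^sub>m"
  shows "L_max N \<alpha> \<eta>\<^sub>e \<eta>\<^sub>r \<eta>\<^sub>d l\<^sub>m 0 0 0 = \<infinity>"
proof -
  have t: "swap_t \<eta> l 0 = 1" if "0 < \<eta>" "0 < l" for \<eta> l
    using that by (simp add: swap_t_def coeff_a_def coeff_b_def coeff_c_def click_A_def)
  have "QBER N \<alpha> \<eta>\<^sub>e \<eta>\<^sub>r \<eta>\<^sub>d l\<^sub>m 0 0 0 L = 0" for L
    using assms
    by (simp add: QBER_def t link_trans_def det_t_def q1_def q2_def q3_def click_Ad_def)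
  then have *: "L_max N \<alpha> \<eta>\<^sub>e \<eta>\<^sub>r \<eta>\<^sub>d l\<^sub>m 0 0 0 = (SUP L\<in>{0..}. ennreal L)"
    using Q_th(1) by (simp add: L_max_def atLeast_def)
  have "of_nat n \<le> (SUP L\<in>{0..}. ennreal L)" for n
    by (rule SUP_upper2 [of "real n"]) (auto simp: ennreal_of_nat_eq_real_of_nat)
  then have "(SUP L\<in>{0..}. ennreal L) = top"
    by (metis ennreal_Ex_less_of_nat leD top.not_eq_extremum)
  then show ?thesis using * by simp
qed

end

theory Submission
  imports Defs
begin

text \<open>The hypothesis reduces the two bounds to the rate without dark clicks, which is explicit:
  the error rate vanishes and the success probability is
  \<open>(\<eta>\<^sub>r\<^sup>2 l\<^sub>m\<^sup>2 / 2)\<^bsup>N - 1\<^esup> (1 - (1 - y)\<^sup>M)\<^sup>N\<close> with \<open>y = \<eta>\<^sub>e\<^sup>2 \<lambda>\<^sup>2 / 2\<close>. Estimating \<open>1 - (1 - y)\<^sup>M\<close> by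
  \<open>1\<close> and, with Bernoulli's inequality, by \<open>M y\<close> yields the two bounds for all \<open>L\<close>, because
  \<open>\<lambda>\<^bsup>2 N\<^esup> = \<eta>\<close>. For \<open>L > L_max\<close> the rate is zero by definition of \<open>L_max\<close>; at \<open>L = L_max\<close> it is
  zero because the error rate is continuous in \<open>L\<close>, so that the supremum is not attained.\<close>

lemma link_trans_pos: "0 < link_trans \<alpha> N L"
  by (simp add: link_trans_def)

lemma link_trans_le_1: "0 \<le> \<alpha> \<Longrightarrow> 0 \<le> L \<Longrightarrow> link_trans \<alpha> N L \<le> 1"
  by (simp add: link_trans_def)

lemma link_trans_power:
  assumes "N \<ge> 1"
  shows "link_trans \<alpha> N L ^ (2 * N) = exp (- \<alpha> * L)"
proof -
  have "real (2 * N) * (- \<alpha> * L / (2 * real N)) = - \<alpha> * L"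
    using assms by (simp add: field_simps)
  then show ?thesis
    unfolding link_trans_def exp_of_nat_mult [symmetric] by simp
qed

lemma swap_s_no_dark: "swap_s \<eta> l 0 = (\<eta> * l)^2 / 8"
  by (simp add: swap_s_def coeff_a_def coeff_b_def coeff_c_def click_A_def)

lemma swap_t_no_dark: "\<eta> * l \<noteq> 0 \<Longrightarrow> swap_t \<eta> l 0 = 1"
  by (simp add: swap_t_def coeff_a_def coeff_b_def coeff_c_def click_A_def)

text \<open>The sum is the denominator of \<open>swap_t\<close>, so positivity is what continuity of
  the error rate rests on. Since \<open>A > 0\<close> and \<open>P < 1\<close>, the term
  \<open>A^2 * (1 - P)^2\<close> of \<open>coeff_a\<close> is positive; every other term is
  nonnegative once \<open>A\<close> and \<open>B\<close> lie in [0, 1].\<close>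

lemma swap_s_pos:
  assumes "0 < \<eta>" "\<eta> \<le> 1" "0 < l" "l \<le> 1" "0 \<le> P" "P < 1"
  shows "0 < swap_s \<eta> l P"
proof -
  define x where "x = \<eta> * l"
  have x: "0 < x" "x \<le> 1"
    using assms by (auto simp: x_def intro: mult_le_one)
  define A where "A = click_A \<eta> l P"
  define B where "B = click_B \<eta> l P"
  \<comment> \<open>No click means neither a dark click nor a photon click, so the complement
    factors, and the range of \<open>A\<close> can be read off. The same is done for
    \<open>B\<close> with two photons.\<close>
  have A_eq: "1 - A = (1 - P) * (1 - x)"
    by (simp add: A_def click_A_def x_def algebra_simps)
  have A: "0 < A" "A \<le> 1"
  proof -
    show "0 < A" using x assms by (simp add: A_def click_A_def x_def add_pos_nonneg)
    have "0 \<le> 1 - A" unfolding A_eq using x assms by simp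
    then show "A \<le> 1" by simp
  qed
  have B_eq: "1 - B = (1 - P) * (1 - x)^2"
    by (simp add: B_def click_B_def x_def)
  have B: "0 \<le> B" "B \<le> 1"
  proof -
    have "(1 - P) * (1 - x)^2 \<le> 1 * 1"
      using x assms by (intro mult_mono power_le_one) auto
    then show "0 \<le> B" using B_eq by simp
    have "0 \<le> 1 - B" unfolding B_eq using assms by simp
    then show "B \<le> 1" by simp
  qed
  have "0 < A^2 * (1 - P)^2" "0 \<le> P^2 * (1 - A)^2"
    using A assms by auto
  then have a: "0 < coeff_a \<eta> l P"
    by (simp add: coeff_a_def Let_def A_def [symmetric] add_nonneg_pos)
  have b: "0 \<le> coeff_b \<eta> l P"
    using A assms by (simp add: coeff_b_def Let_def A_def [symmetric])
  have c: "0 \<le> coeff_c \<eta> l P"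
    using B assms by (simp add: coeff_c_def Let_def B_def [symmetric])
  from a b c show ?thesis by (simp add: swap_s_def)
qed

text \<open>The range enters only through \<open>link_trans\<close>. The coefficients are
  polynomials in the transmissivity, and the division by the \<open>swap_t\<close> of index r is by
  a constant.\<close>

lemma isCont_QBER:
  assumes "N \<ge> 1" "0 \<le> \<alpha>" "0 < \<eta>\<^sub>e" "\<eta>\<^sub>e \<le> 1" "0 \<le> P\<^sub>e" "P\<^sub>e < 1" "0 \<le> L"
  shows "isCont (\<lambda>L. QBER N \<alpha> \<eta>\<^sub>e \<eta>\<^sub>r \<eta>\<^sub>d l\<^sub>m P\<^sub>e P\<^sub>r P\<^sub>d L) L"
proof -
  have link: "isCont (link_trans \<alpha> N) L"
    unfolding link_trans_def [abs_def] using assms(1) by (intro continuous_intros) auto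
  have coeffs: "isCont (\<lambda>l. coeff_a \<eta>\<^sub>e l P\<^sub>e) x" "isCont (\<lambda>l. coeff_b \<eta>\<^sub>e l P\<^sub>e) x"
    "isCont (\<lambda>l. coeff_c \<eta>\<^sub>e l P\<^sub>e) x" for x
    unfolding coeff_a_def coeff_b_def coeff_c_def click_A_def click_B_def Let_def
    by (intro continuous_intros)+
  \<comment> \<open>This is where \<open>0 \<le> L\<close> enters: it keeps the transmissivity at
    most 1.\<close>
  have "swap_s \<eta>\<^sub>e (link_trans \<alpha> N L) P\<^sub>e > 0"
    using assms by (intro swap_s_pos link_trans_pos link_trans_le_1)
  then have "isCont (\<lambda>l. swap_t \<eta>\<^sub>e l P\<^sub>e) (link_trans \<alpha> N L)"
    unfolding swap_t_def swap_s_def by (intro continuous_intros coeffs) simp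
  then have "isCont (\<lambda>L. swap_t \<eta>\<^sub>e (link_trans \<alpha> N L) P\<^sub>e) L"
    by (rule isCont_o2 [OF link])
  then show ?thesis
    unfolding QBER_def by (intro continuous_intros)
qed

text \<open>If the error rate at \<open>L\<close> were below the threshold, it would stay below it
  slightly to the right of \<open>L\<close>, and such a larger range could not exceed the supremum.
  This treats \<open>L = L_max\<close> and \<open>L > L_max\<close> alike.\<close>

lemma QBER_ge_Q_th_beyond_L_max:
  assumes "N \<ge> 1" "0 \<le> \<alpha>" "0 < \<eta>\<^sub>e" "\<eta>\<^sub>e \<le> 1" "0 \<le> P\<^sub>e" "P\<^sub>e < 1" "0 \<le> L"
    and "L_max N \<alpha> \<eta>\<^sub>e \<eta>\<^sub>r \<eta>\<^sub>d l\<^sub>m P\<^sub>e P\<^sub>r P\<^sub>d \<le> ennreal L"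
  shows "Q_th \<le> QBER N \<alpha> \<eta>\<^sub>e \<eta>\<^sub>r \<eta>\<^sub>d l\<^sub>m P\<^sub>e P\<^sub>r P\<^sub>d L"
proof (rule ccontr)
  let ?Q = "QBER N \<alpha> \<eta>\<^sub>e \<eta>\<^sub>r \<eta>\<^sub>d l\<^sub>m P\<^sub>e P\<^sub>r P\<^sub>d"
  assume "\<not> Q_th \<le> ?Q L"
  then have "?Q L < Q_th" by simp
  moreover have "(?Q \<longlongrightarrow> ?Q L) (at_right L)"
    using isCont_QBER [OF assms(1-7)] by (simp add: isCont_def filterlim_at_split)
  ultimately have "eventually (\<lambda>l. ?Q l < Q_th) (at_right L)"
    by (rule order_tendstoD(2) [rotated])
  then obtain u where u: "L < u" "\<And>l. L < l \<Longrightarrow> l < u \<Longrightarrow> ?Q l < Q_th"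
    unfolding eventually_at_right_field by blast
  obtain l where l: "L < l" "l < u"
    using dense [OF u(1)] by blast
  have "ennreal l \<le> L_max N \<alpha> \<eta>\<^sub>e \<eta>\<^sub>r \<eta>\<^sub>d l\<^sub>m P\<^sub>e P\<^sub>r P\<^sub>d"
    unfolding L_max_def using l u \<open>0 \<le> L\<close> by (intro SUP_upper) auto
  also have "\<dots> \<le> ennreal L" by fact
  \<comment> \<open>\<open>ennreal\<close> sends negative reals to 0, so the sign of
    \<open>L\<close> matters when the comparison is pulled back to the reals.\<close>
  finally show False using l(1) \<open>0 \<le> L\<close> by (simp add: ennreal_le_iff)
qed

lemma key_rate0_eq:
  assumes "0 < \<eta>\<^sub>e" "0 < \<eta>\<^sub>r" "0 < \<eta>\<^sub>d" "0 < l\<^sub>m"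
  shows "key_rate0 N M \<alpha> T\<^sub>q \<eta>\<^sub>e \<eta>\<^sub>r \<eta>\<^sub>d l\<^sub>m L = \<eta>\<^sub>d^2 / (2 * T\<^sub>q) * (\<eta>\<^sub>r^2 * l\<^sub>m^2 / 2)^(N - 1)
    * (1 - (1 - \<eta>\<^sub>e^2 * (link_trans \<alpha> N L)^2 / 2)^M)^N"
proof -
  have "QBER N \<alpha> \<eta>\<^sub>e \<eta>\<^sub>r \<eta>\<^sub>d l\<^sub>m 0 0 0 L = 0"
    using assms link_trans_pos [of \<alpha> N L]
    by (simp add: QBER_def swap_t_no_dark det_t_def q1_def q2_def q3_def click_Ad_def)
  \<comment> \<open>The factor 0 removes the term with \<open>log 2 0\<close>.\<close>
  moreover have "R2 0 = 1"
    by (simp add: R2_def h2_def)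
  moreover have "det_P1 \<eta>\<^sub>d 0 = \<eta>\<^sub>d^2"
    by (simp add: det_P1_def q1_def q2_def q3_def click_Ad_def)
  ultimately show ?thesis
    using Q_th(1)
    by (simp add: key_rate0_def key_rate_def P_succ_def swap_s_no_dark power_mult_distrib)
qed

text \<open>When \<open>y\<close> is a success probability, this is the union bound over
  \<open>M\<close> attempts.\<close>

lemma one_minus_power_le:
  fixes y :: real
  assumes "y \<le> 1"
  shows "1 - (1 - y)^M \<le> real M * y"
  using Bernoulli_inequality [of "- y" M] assms by simp

lemma key_rate0_bounds:
  fixes \<alpha> T\<^sub>q \<eta>\<^sub>e \<eta>\<^sub>r \<eta>\<^sub>d l\<^sub>m L :: real
  assumes "N \<ge> 1" "0 \<le> \<alpha>" "0 < T\<^sub>q" "0 < \<eta>\<^sub>e" "\<eta>\<^sub>e \<le> 1" "0 < \<eta>\<^sub>r" "0 < \<eta>\<^sub>d" "0 < l\<^sub>m" "0 \<le> L"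
  defines "A \<equiv> \<eta>\<^sub>d^2 / (\<eta>\<^sub>r^2 * l\<^sub>m^2 * T\<^sub>q)"
  shows "key_rate0 N M \<alpha> T\<^sub>q \<eta>\<^sub>e \<eta>\<^sub>r \<eta>\<^sub>d l\<^sub>m L \<le> A * (\<eta>\<^sub>r^2 * l\<^sub>m^2 / 2)^N"
    and "key_rate0 N M \<alpha> T\<^sub>q \<eta>\<^sub>e \<eta>\<^sub>r \<eta>\<^sub>d l\<^sub>m L
      \<le> exp (- \<alpha> * L) * (A * (\<eta>\<^sub>r^2 * l\<^sub>m^2 * \<eta>\<^sub>e^2 * real M / 4)^N)"
proof -
  define x where "x = \<eta>\<^sub>r^2 * l\<^sub>m^2"
  define y where "y = \<eta>\<^sub>e^2 * (link_trans \<alpha> N L)^2 / 2"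
  define w where "w = 1 - (1 - y)^M"
  define K where "K = A * (x / 2)^N"
  have "x > 0" using assms by (simp add: x_def)
  \<comment> \<open>One factor \<open>x / 2\<close> of the power cancels the \<open>x\<close> in the
    denominator of \<open>A\<close>; this needs \<open>N \<ge> 1\<close>.\<close>
  have "K = \<eta>\<^sub>d^2 / (2 * T\<^sub>q) * (x / 2)^(N - 1)"
    using \<open>N \<ge> 1\<close> \<open>x > 0\<close> by (cases N) (simp_all add: K_def A_def x_def [symmetric])
  then have rate: "key_rate0 N M \<alpha> T\<^sub>q \<eta>\<^sub>e \<eta>\<^sub>r \<eta>\<^sub>d l\<^sub>m L = K * w^N"
    using assms by (simp add: key_rate0_eq w_def y_def x_def)
  have "K \<ge> 0" using \<open>x > 0\<close> \<open>T\<^sub>q > 0\<close> by (simp add: K_def A_def x_def [symmetric])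
  have "\<eta>\<^sub>e^2 * (link_trans \<alpha> N L)^2 \<le> 1"
    using assms link_trans_pos [of \<alpha> N L] link_trans_le_1 [of \<alpha> L N]
    by (intro mult_le_one power_le_one) auto
  then have y: "0 \<le> y" "y \<le> 1" by (auto simp: y_def)
  then have w: "0 \<le> w" "w \<le> 1" "w \<le> real M * y"
    using one_minus_power_le [of y M] by (auto simp: w_def power_le_one)
  show "key_rate0 N M \<alpha> T\<^sub>q \<eta>\<^sub>e \<eta>\<^sub>r \<eta>\<^sub>d l\<^sub>m L \<le> A * (\<eta>\<^sub>r^2 * l\<^sub>m^2 / 2)^N"
    using mult_left_mono [OF power_le_one [OF w(1,2), of N] \<open>K \<ge> 0\<close>]
    by (simp add: rate K_def x_def)
  have "K * w^N \<le> K * (real M * y)^N"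
    using w \<open>K \<ge> 0\<close> by (intro mult_left_mono power_mono)
  also have "\<dots> = A * (x / 2 * (real M * y))^N"
    by (simp only: K_def power_mult_distrib mult.assoc)
  \<comment> \<open>Regrouping separates a factor independent of \<open>L\<close> from the squared
    transmissivity, whose \<open>N\<close>-th power is \<open>exp (- \<alpha> * L)\<close>.\<close>
  also have "x / 2 * (real M * y) = x * \<eta>\<^sub>e^2 * real M / 4 * (link_trans \<alpha> N L)^2"
    by (simp add: y_def)
  also have "A * \<dots>^N = exp (- \<alpha> * L) * (A * (x * \<eta>\<^sub>e^2 * real M / 4)^N)"
    unfolding power_mult_distrib [of _ "(link_trans \<alpha> N L)^2"] power_mult [symmetric]
      link_trans_power [OF \<open>N \<ge> 1\<close>] by (simp only: mult.assoc mult.commute mult.left_commute)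
  finally show "key_rate0 N M \<alpha> T\<^sub>q \<eta>\<^sub>e \<eta>\<^sub>r \<eta>\<^sub>d l\<^sub>m L
      \<le> exp (- \<alpha> * L) * (A * (\<eta>\<^sub>r^2 * l\<^sub>m^2 * \<eta>\<^sub>e^2 * real M / 4)^N)"
    by (simp add: rate x_def)
qed

theorem theorem3:
  fixes N M :: nat
    and \<alpha> T\<^sub>q \<eta>\<^sub>e \<eta>\<^sub>r \<eta>\<^sub>d l\<^sub>m P\<^sub>e P\<^sub>r P\<^sub>d L A B R_max \<eta> \<eta>' L' :: real
  assumes "N \<ge> 1" and "M \<ge> 1"
    and "\<alpha> > 0" and "T\<^sub>q > 0"
    and "\<eta>\<^sub>e \<in> {0<..1}" and "\<eta>\<^sub>r \<in> {0<..1}" and "\<eta>\<^sub>d \<in> {0<..1}" and "l\<^sub>m \<in> {0<..1}"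
    and "P\<^sub>e \<in> {0..<1}" and "P\<^sub>r \<in> {0..<1}" and "P\<^sub>d \<in> {0..<1}" and "P\<^sub>r \<noteq> 1/2"
    and dark: "\<forall>l\<ge>0. key_rate N M \<alpha> T\<^sub>q \<eta>\<^sub>e \<eta>\<^sub>r \<eta>\<^sub>d l\<^sub>m P\<^sub>e P\<^sub>r P\<^sub>d l
                    \<le> key_rate0 N M \<alpha> T\<^sub>q \<eta>\<^sub>e \<eta>\<^sub>r \<eta>\<^sub>d l\<^sub>m l"
    and "L \<ge> 0"
  defines "\<eta> \<equiv> exp (- \<alpha> * L)"
    and "A \<equiv> \<eta>\<^sub>d^2 / (\<eta>\<^sub>r^2 * l\<^sub>m^2 * T\<^sub>q)"
    and "B \<equiv> \<eta>\<^sub>r^2 * l\<^sub>m^2 * \<eta>\<^sub>e^2 * real M / 4"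
    and "R_max \<equiv> A * (\<eta>\<^sub>r^2 * l\<^sub>m^2 / 2)^N"
    and "\<eta>' \<equiv> (2 / (real M * \<eta>\<^sub>e^2))^N"
    and "L' \<equiv> - ln \<eta>' / \<alpha>"
  shows "(L \<le> L' \<longrightarrow> key_rate N M \<alpha> T\<^sub>q \<eta>\<^sub>e \<eta>\<^sub>r \<eta>\<^sub>d l\<^sub>m P\<^sub>e P\<^sub>r P\<^sub>d L \<le> R_max)
       \<and> (L' < L \<and> ennreal L < L_max N \<alpha> \<eta>\<^sub>e \<eta>\<^sub>r \<eta>\<^sub>d l\<^sub>m P\<^sub>e P\<^sub>r P\<^sub>d
            \<longrightarrow> key_rate N M \<alpha> T\<^sub>q \<eta>\<^sub>e \<eta>\<^sub>r \<eta>\<^sub>d l\<^sub>m P\<^sub>e P\<^sub>r P\<^sub>d L \<le> \<eta> * (A * B^N))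
       \<and> (L_max N \<alpha> \<eta>\<^sub>e \<eta>\<^sub>r \<eta>\<^sub>d l\<^sub>m P\<^sub>e P\<^sub>r P\<^sub>d \<le> ennreal L
            \<longrightarrow> key_rate N M \<alpha> T\<^sub>q \<eta>\<^sub>e \<eta>\<^sub>r \<eta>\<^sub>d l\<^sub>m P\<^sub>e P\<^sub>r P\<^sub>d L \<le> 0)"
proof -
  have le: "key_rate N M \<alpha> T\<^sub>q \<eta>\<^sub>e \<eta>\<^sub>r \<eta>\<^sub>d l\<^sub>m P\<^sub>e P\<^sub>r P\<^sub>d L \<le> key_rate0 N M \<alpha> T\<^sub>q \<eta>\<^sub>e \<eta>\<^sub>r \<eta>\<^sub>d l\<^sub>m L"
    using dark \<open>L \<ge> 0\<close> by simp
  \<comment> \<open>The first two bounds coincide exactly when \<open>\<eta> = \<eta>'\<close>, that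
    is at \<open>L = L'\<close>; the case split thus selects the smaller one on each side.\<close>
  have "key_rate N M \<alpha> T\<^sub>q \<eta>\<^sub>e \<eta>\<^sub>r \<eta>\<^sub>d l\<^sub>m P\<^sub>e P\<^sub>r P\<^sub>d L \<le> R_max"
    using assms(1-14) unfolding R_max_def A_def
    by (intro order_trans [OF le] key_rate0_bounds(1)) auto
  moreover have "key_rate N M \<alpha> T\<^sub>q \<eta>\<^sub>e \<eta>\<^sub>r \<eta>\<^sub>d l\<^sub>m P\<^sub>e P\<^sub>r P\<^sub>d L \<le> \<eta> * (A * B^N)"
    using assms(1-14) unfolding \<eta>_def A_def B_def
    by (intro order_trans [OF le] key_rate0_bounds(2)) auto
  moreover have "key_rate N M \<alpha> T\<^sub>q \<eta>\<^sub>e \<eta>\<^sub>r \<eta>\<^sub>d l\<^sub>m P\<^sub>e P\<^sub>r P\<^sub>d L \<le> 0"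
    if "L_max N \<alpha> \<eta>\<^sub>e \<eta>\<^sub>r \<eta>\<^sub>d l\<^sub>m P\<^sub>e P\<^sub>r P\<^sub>d \<le> ennreal L"
  proof -
    have "Q_th \<le> QBER N \<alpha> \<eta>\<^sub>e \<eta>\<^sub>r \<eta>\<^sub>d l\<^sub>m P\<^sub>e P\<^sub>r P\<^sub>d L"
      using assms(1-14) that by (intro QBER_ge_Q_th_beyond_L_max) auto
    then show ?thesis by (simp add: key_rate_def)
  qed
  ultimately show ?thesis by blast
qed

end
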